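(* Let $\alpha(u)=(u,f_1(u),f_2(u))$ be a smooth space curve in the Galilean space $\mathbb{G}_3$ and let $\beta(v)=(v,g(v),av)$, with $a\in\mathbb{R}$ and $g$ smooth, be a planar non-isotropic curve, both defined on open intervals. If the (regular) translation surface $$r(u,v)=\alpha(u)+\beta(v)=\bigl(u+v,\;f_1(u)+g(v),\;f_2(u)+av\bigr)$$ has constant Gaussian curvature $K_0$, then it is a generalized cylinder with non-isotropic rulings (and $K_0=0$).
   Context: The affine model of the Galilean 3-space $\mathbb{G}_3$ is $\mathbb{R}^3$ with coordinates $(x,y,z)$. A vector is isotropic if its first component is $0$, and non-isotropic otherwise. A curve $\alpha(u)=(u,f_1(u),f_2(u))$ is a space curve if its torsion is nowhere zero, i.e. $f_1''f_2'''-f_1'''f_2''\neq 0$ at every $u$. Curvatures of a surface $r(u_1,u_2)=(x,y,z)$ (with $x_{,i}=\partial x/\partial u_i$, $x_{,ij}=\partial^2x/\partial u_i\partial u_j$, etc.): assume $x_{,i}\ne 0$ for some $i$ at each point (admissibility), and set $$W=\sqrt{(x_{,1}z_{,2}-x_{,2}z_{,1})^2+(x_{,2}y_{,1}-x_{,1}y_{,2})^2},\qquad N=\tfrac1W\bigl(0,\,-x_{,1}z_{,2}+x_{,2}z_{,1},\,x_{,1}y_{,2}-x_{,2}y_{,1}\bigr),$$ where regularity means $W>0$ everywhere, and $$L_{ij}=\tfrac1{x_{,k}}\bigl(x_{,k}(0,y_{,ij},z_{,ij})-x_{,ij}(0,y_{,k},z_{,k})\bigr)\cdot N$$ for an index $k$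 with $x_{,k}\neq 0$, where $\cdot$ is the Euclidean scalar product. The Gaussian curvature is $K=(L_{11}L_{22}-L_{12}^2)/W^2$. For the surface in the claim, $W^2=(f_2'-a)^2+(f_1'-g')^2$. A generalized cylinder (cylindrical surface) is a surface that can be parameterized as $\gamma(t)+\lambda e$ with $\gamma$ a curve and $e\neq 0$ a constant vector; its rulings are non-isotropic if $e$ is non-isotropic. *)

theory Defs
  imports "HOL-Analysis.Analysis"
begin

fun dir_deriv :: "('a::real_normed_vector \<Rightarrow> 'b::real_normed_vector) \<Rightarrow> 'a list \<Rightarrow> 'a \<Rightarrow> 'b"
  where
    "dir_deriv f [] = f"
  | "dir_deriv f (w # ws) = (\<lambda>x. frechet_derivative (dir_deriv f ws) (at x) w)"

(* Between finite-dimensional spaces this is C^infinity on the open set S: all iterated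
   directional derivatives exist and are differentiable, in particular continuous. *)
definition smooth_on :: "'a::euclidean_space set \<Rightarrow> ('a \<Rightarrow> 'b::euclidean_space) \<Rightarrow> bool"
  where "smooth_on S f \<longleftrightarrow> open S \<and> (\<forall>ws. dir_deriv f ws differentiable_on S)"

definition diffeomorphism :: "'a::euclidean_space set \<Rightarrow> 'b::euclidean_space set \<Rightarrow> ('a \<Rightarrow> 'b) \<Rightarrow> bool"
  where "diffeomorphism S T \<phi> \<longleftrightarrow>
    smooth_on S \<phi> \<and> \<phi> ` S = T \<and> (\<exists>\<psi>. smooth_on T \<psi> \<and> (\<forall>p\<in>S. \<psi> (\<phi> p) = p))"

definition open_interval :: "real set \<Rightarrow> bool"
  where "open_interval I \<longleftrightarrow> open I \<and> is_interval I \<and> I \<noteq> {}"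

definition rect :: "real set \<Rightarrow> real set \<Rightarrow> (real ^ 2) set"
  where "rect I J = {p. p $ 1 \<in> I \<and> p $ 2 \<in> J}"


definition isotropic :: "real ^ 3 \<Rightarrow> bool"
  where "isotropic w \<longleftrightarrow> w $ 1 = 0"

definition graph_curve :: "(real \<Rightarrow> real) \<Rightarrow> (real \<Rightarrow> real) \<Rightarrow> real \<Rightarrow> real ^ 3"
  where "graph_curve f1 f2 u = vector [u, f1 u, f2 u]"

(* The torsion of graph_curve f1 f2 vanishes exactly where this determinant does. *)
definition space_curve_on :: "real set \<Rightarrow> (real \<Rightarrow> real) \<Rightarrow> (real \<Rightarrow> real) \<Rightarrow> bool"
  where "space_curve_on I f1 f2 \<longleftrightarrow>
    (\<forall>u\<in>I. (deriv ^^ 2) f1 u * (deriv ^^ 3) f2 u - (deriv ^^ 3) f1 u * (deriv ^^ 2) f2 u \<noteq> 0)"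

definition translation_surface :: "(real \<Rightarrow> real ^ 3) \<Rightarrow> (real \<Rightarrow> real ^ 3) \<Rightarrow> real ^ 2 \<Rightarrow> real ^ 3"
  where "translation_surface \<alpha> \<beta> p = \<alpha> (p $ 1) + \<beta> (p $ 2)"


(* A parametrized surface is a map r on an open set of parameters p = (u1, u2).  The components
   1, 2, 3 of pd i r and of pd i (pd j r) are x,i  y,i  z,i  and  x,ij  y,ij  z,ij. *)
definition pd :: "2 \<Rightarrow> (real ^ 2 \<Rightarrow> real ^ 3) \<Rightarrow> real ^ 2 \<Rightarrow> real ^ 3"
  where "pd i r p = frechet_derivative r (at p) (axis i 1)"

definition surf_W :: "(real ^ 2 \<Rightarrow> real ^ 3) \<Rightarrow> real ^ 2 \<Rightarrow> real"
  where "surf_W r p =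
    sqrt ((pd 1 r p $ 1 * pd 2 r p $ 3 - pd 2 r p $ 1 * pd 1 r p $ 3)\<^sup>2
        + (pd 2 r p $ 1 * pd 1 r p $ 2 - pd 1 r p $ 1 * pd 2 r p $ 2)\<^sup>2)"

definition surf_N :: "(real ^ 2 \<Rightarrow> real ^ 3) \<Rightarrow> real ^ 2 \<Rightarrow> real ^ 3"
  where "surf_N r p = (1 / surf_W r p) *\<^sub>R
    vector [0,
            - pd 1 r p $ 1 * pd 2 r p $ 3 + pd 2 r p $ 1 * pd 1 r p $ 3,
            pd 1 r p $ 1 * pd 2 r p $ 2 - pd 2 r p $ 1 * pd 1 r p $ 2]"

definition admissible_on :: "(real ^ 2) set \<Rightarrow> (real ^ 2 \<Rightarrow> real ^ 3) \<Rightarrow> bool"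
  where "admissible_on D r \<longleftrightarrow> (\<forall>p\<in>D. \<exists>i. pd i r p $ 1 \<noteq> 0)"

definition regular_on :: "(real ^ 2) set \<Rightarrow> (real ^ 2 \<Rightarrow> real ^ 3) \<Rightarrow> bool"
  where "regular_on D r \<longleftrightarrow> admissible_on D r \<and> (\<forall>p\<in>D. surf_W r p > 0)"

(* Any k with x,k nonzero gives the same value: N is orthogonal to
   (1 / x,1) (0, y,1, z,1) - (1 / x,2) (0, y,2, z,2). *)
definition surf_L :: "(real ^ 2 \<Rightarrow> real ^ 3) \<Rightarrow> 2 \<Rightarrow> 2 \<Rightarrow> real ^ 2 \<Rightarrow> real"
  where "surf_L r i j p =
    (let k = (SOME k. pd k r p $ 1 \<noteq> 0) in
      ((1 / pd k r p $ 1) *\<^sub>R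
        (pd k r p $ 1 *\<^sub>R vector [0, pd i (pd j r) p $ 2, pd i (pd j r) p $ 3]
          - pd i (pd j r) p $ 1 *\<^sub>R vector [0, pd k r p $ 2, pd k r p $ 3])) \<bullet> surf_N r p)"

definition gauss_curvature :: "(real ^ 2 \<Rightarrow> real ^ 3) \<Rightarrow> real ^ 2 \<Rightarrow> real"
  where "gauss_curvature r p =
    (surf_L r 1 1 p * surf_L r 2 2 p - (surf_L r 1 2 p)\<^sup>2) / (surf_W r p)\<^sup>2"

(* The surface r on D is, up to a change of parameters \<phi>, of the form \<gamma>(t) + \<lambda> e. *)
definition generalized_cylinder_along :: "(real ^ 2) set \<Rightarrow> (real ^ 2 \<Rightarrow> real ^ 3) \<Rightarrow> real ^ 3 \<Rightarrow> bool"
  where "generalized_cylinder_along D r e \<longleftrightarrow> e \<noteq> 0 \<and>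
    (\<exists>T \<Lambda> \<gamma> \<phi>. open_interval T \<and> open_interval \<Lambda> \<and> smooth_on T \<gamma> \<and>
       diffeomorphism (rect T \<Lambda>) D \<phi> \<and>
       (\<forall>p\<in>rect T \<Lambda>. r (\<phi> p) = \<gamma> (p $ 1) + (p $ 2) *\<^sub>R e))"

end

theory Submission
  imports Defs "HOL-Computational_Algebra.Polynomial"
begin

text \<open>
  Write \<open>A = f1'(u)\<close>, \<open>B = f2'(u) - a\<close> and \<open>G = g'(v)\<close>. The curvature condition reads
  \<open>g'' B (A' B + B' (G - A)) = K0 (B\<^sup>2 + (G - A)\<^sup>2)\<^sup>2\<close>. Suppose that \<open>g''\<close> does not vanish
  identically; then \<open>G\<close> takes infinitely many values. If \<open>K0 = 0\<close>, the polynomial in \<open>G\<close> on the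
  left vanishes, which contradicts the torsion condition. If \<open>K0 \<noteq> 0\<close>, eliminating \<open>g''\<close> between
  two parameters \<open>u\<close> and \<open>w\<close> gives a polynomial identity in \<open>G\<close>. Evaluating it at the complex
  root \<open>A + iB\<close> of the right-hand side at \<open>u\<close> shows that \<open>A\<close> takes the same value at \<open>u\<close> and at \<open>w\<close>,
  so \<open>A\<close> is constant, which again contradicts the torsion condition.
  Hence \<open>g\<close> is affine, and its graph is the ruling.
\<close>

section \<open>Smooth maps\<close>

text \<open>Frechet derivatives are unique, and on an open set they depend only on the values there.
  So, by induction on the list, candidates \<open>D ws\<close> that differentiate into one another
  must be the iterated derivatives.\<close>

lemma dir_deriv_family:
  fixes f :: "'a::euclidean_space \<Rightarrow> 'b::euclidean_space"
  assumes "open S" and "\<And>x. x \<in> S \<Longrightarrow> D [] x = f x"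
    and "\<And>ws x. x \<in> S \<Longrightarrow> (D ws has_derivative (\<lambda>w. D (w # ws) x)) (at x)"
    and "x \<in> S"
  shows "dir_deriv f ws x = D ws x" "(dir_deriv f ws has_derivative (\<lambda>w. D (w # ws) x)) (at x)"
proof -
  have transfer: "(dir_deriv f ws has_derivative (\<lambda>w. D (w # ws) y)) (at y)"
    if "\<forall>y\<in>S. dir_deriv f ws y = D ws y" "y \<in> S" for ws y
    using has_derivative_transform_within_open[OF assms(3)[OF that(2)] assms(1) that(2)] that
    by simp
  have eq: "\<forall>x\<in>S. dir_deriv f ws x = D ws x" for ws
  proof (induction ws)
    case Nil
    then show ?case using assms(2) by simp
  next
    case (Cons w ws)
    then show ?case
      using frechet_derivative_at[OF transfer[OF Cons]] by (metis dir_deriv.simps(2))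
  qed
  show "dir_deriv f ws x = D ws x" using eq assms(4) by blast
  show "(dir_deriv f ws has_derivative (\<lambda>w. D (w # ws) x)) (at x)"
    using transfer eq assms(4) by blast
qed

text \<open>Criterion behind the closure rules below: giving closed formulas for all iterated
  derivatives at once replaces a separate induction for each rule.\<close>

lemma smooth_on_family:
  fixes f :: "'a::euclidean_space \<Rightarrow> 'b::euclidean_space"
  assumes "open S" and "\<And>x. x \<in> S \<Longrightarrow> D [] x = f x"
    and "\<And>ws x. x \<in> S \<Longrightarrow> (D ws has_derivative (\<lambda>w. D (w # ws) x)) (at x)"
  shows "smooth_on S f"
  unfolding smooth_on_def differentiable_on_def
  using dir_deriv_family(2)[of S D f, OF assms] assms(1)
  by (meson differentiableI has_derivative_at_withinI)

lemma smooth_on_dir_deriv: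
  assumes "smooth_on S f" "x \<in> S"
  shows "(dir_deriv f ws has_derivative (\<lambda>w. dir_deriv f (w # ws) x)) (at x)"
proof -
  have "dir_deriv f ws differentiable (at x)"
    using assms unfolding smooth_on_def differentiable_on_def by (metis at_within_open)
  then show ?thesis
    by (simp add: frechet_derivative_works)
qed

lemma smooth_on_add:
  assumes "smooth_on S f" "smooth_on S g"
  shows "smooth_on S (\<lambda>x. f x + g x)"
proof (rule smooth_on_family[where D = "\<lambda>ws x. dir_deriv f ws x + dir_deriv g ws x"])
  show "open S" using assms(1) by (simp add: smooth_on_def)
qed (auto simp del: dir_deriv.simps(2)
    intro: has_derivative_add[OF smooth_on_dir_deriv[OF assms(1)] smooth_on_dir_deriv[OF assms(2)]])

lemma smooth_on_bounded_linear_compose: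
  assumes "bounded_linear L" "smooth_on S f"
  shows "smooth_on S (\<lambda>x. L (f x))"
proof (rule smooth_on_family[where D = "\<lambda>ws x. L (dir_deriv f ws x)"])
  show "open S" using assms(2) by (simp add: smooth_on_def)
qed (auto simp del: dir_deriv.simps(2)
    intro: bounded_linear.has_derivative[OF assms(1) smooth_on_dir_deriv[OF assms(2)]])

lemma smooth_on_const:
  assumes "open S"
  shows "smooth_on S (\<lambda>x. c)"
  by (rule smooth_on_family[where D = "\<lambda>ws x. if ws = [] then c else 0"]) (use assms in auto)

lemma smooth_on_ident:
  assumes "open S"
  shows "smooth_on S (\<lambda>x. x)"
proof (rule smooth_on_family[where D = "\<lambda>ws x. case ws of [] \<Rightarrow> x | [w] \<Rightarrow> w | _ \<Rightarrow> 0"])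
  fix ws and x :: 'a
  show "((\<lambda>x. case ws of [] \<Rightarrow> x | [w] \<Rightarrow> w | _ \<Rightarrow> 0) has_derivative
      (\<lambda>w. case w # ws of [] \<Rightarrow> x | [w] \<Rightarrow> w | _ \<Rightarrow> 0)) (at x)"
    by (cases ws; cases "tl ws") auto
qed (use assms in auto)

text \<open>On the line, direction 1 determines every directional derivative, so
  \<open>(deriv ^^ n) f\<close> agrees on \<open>S\<close> with \<open>dir_deriv\<close> along
  \<open>n\<close> copies of 1.\<close>

lemma smooth_on_higher_deriv:
  fixes f :: "real \<Rightarrow> real"
  assumes "smooth_on S f" "x \<in> S"
  shows "((deriv ^^ n) f has_real_derivative (deriv ^^ Suc n) f x) (at x)"
proof -
  have S: "open S" using assms(1) by (simp add: smooth_on_def)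
  have transfer: "((deriv ^^ n) f has_real_derivative dir_deriv f (1 # replicate n 1) y) (at y)"
    if "\<forall>y\<in>S. dir_deriv f (replicate n 1) y = (deriv ^^ n) f y" "y \<in> S" for n y
  proof -
    have *: "((deriv ^^ n) f has_derivative (\<lambda>w. dir_deriv f (w # replicate n 1) y)) (at y)"
      using has_derivative_transform_within_open
        [OF smooth_on_dir_deriv[OF assms(1) that(2)] S that(2)] that(1) by blast
    interpret bounded_linear "\<lambda>w. dir_deriv f (w # replicate n 1) y"
      using * by (rule has_derivative_bounded_linear)
    \<comment> \<open>A linear map on the reals is multiplication by its value at 1.\<close>
    have "(\<lambda>w. dir_deriv f (w # replicate n 1) y) = (*) (dir_deriv f (1 # replicate n 1) y)"
    proof
      fix w
      show "dir_deriv f (w # replicate n 1) y = dir_deriv f (1 # replicate n 1) y * w"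
        using scaleR[of w 1] by (simp add: mult.commute del: dir_deriv.simps)
    qed
    with * show ?thesis unfolding has_field_derivative_def by (simp only:)
  qed
  have eq: "\<forall>y\<in>S. dir_deriv f (replicate n 1) y = (deriv ^^ n) f y" for n
  proof (induction n)
    case 0
    then show ?case by simp
  next
    case (Suc n)
    then show ?case using DERIV_imp_deriv[OF transfer[OF Suc]] by simp
  qed
  have "((deriv ^^ n) f has_real_derivative dir_deriv f (replicate (Suc n) 1) x) (at x)"
    using transfer[OF eq assms(2)] by simp
  then show ?thesis using eq[of "Suc n"] assms(2) by (simp only:)
qed

lemma smooth_on_deriv:
  fixes f :: "real \<Rightarrow> real"
  assumes "smooth_on S f" "x \<in> S"
  shows "(f has_real_derivative deriv f x) (at x)"
    and "(deriv f has_real_derivative (deriv ^^ 2) f x) (at x)"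
  using smooth_on_higher_deriv[OF assms, of 0] smooth_on_higher_deriv[OF assms, of 1]
  by (simp_all add: numeral_2_eq_2)

section \<open>Curvature of a translation surface\<close>

text \<open>With constant basis vectors, the rules for sums and scalar multiples settle both
  differentiability and smoothness of space-valued maps.\<close>

lemma vector_3_eq_axis_sum:
  fixes x y z :: real
  shows "(vector [x, y, z] :: real ^ 3) = x *\<^sub>R axis 1 1 + y *\<^sub>R axis 2 1 + z *\<^sub>R axis 3 1"
  by (simp add: vec_eq_iff forall_3 axis_def)

lemma has_derivative_vector_3:
  fixes f1 f2 f3 :: "'a::real_normed_vector \<Rightarrow> real"
  assumes "(f1 has_derivative d1) F" "(f2 has_derivative d2) F" "(f3 has_derivative d3) F"
  shows "((\<lambda>x. vector [f1 x, f2 x, f3 x] :: real ^ 3)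
    has_derivative (\<lambda>w. vector [d1 w, d2 w, d3 w])) F"
  unfolding vector_3_eq_axis_sum
  by (intro has_derivative_add has_derivative_scaleR_left assms)

lemma has_derivative_of_component:
  fixes f :: "real \<Rightarrow> real" and p :: "real ^ 'n"
  assumes "(f has_real_derivative d) (at (p $ i))"
  shows "((\<lambda>q. f (q $ i)) has_derivative (\<lambda>w. d * w $ i)) (at p)"
proof -
  have "((\<lambda>q. q $ i) has_derivative (\<lambda>w. w $ i)) (at p)"
    by (rule bounded_linear_imp_has_derivative[OF bounded_linear_vec_nth])
  from has_derivative_compose[OF this assms[unfolded has_field_derivative_def]]
  show ?thesis .
qed

lemma open_rect:
  assumes "open I" "open J"
  shows "open (rect I J)"
proof -
  have "rect I J = (\<lambda>p. p $ 1) -` I \<inter> (\<lambda>p. p $ 2) -` J"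
    by (auto simp: rect_def)
  then show ?thesis
    using assms by (simp add: open_Int open_vimage_vec_nth)
qed

text \<open>Makes nested \<open>pd\<close> computable: the inner partial derivative is known
  explicitly only on the open domain, which is enough for the outer one.\<close>

lemma pd_eq:
  assumes "open D" "p \<in> D" "\<And>q. q \<in> D \<Longrightarrow> r q = s q" "(s has_derivative s') (at p)"
  shows "pd i r p = s' (axis i 1)"
proof -
  have "(r has_derivative s') (at p)"
    using has_derivative_transform_within_open[OF assms(4,1,2)] assms(3) by simp
  then show ?thesis
    unfolding pd_def by (simp add: frechet_derivative_at[symmetric])
qed

lemma translation_surface_eq:
  "translation_surface (graph_curve f1 f2) (graph_curve g h) p =
    vector [p $ 1 + p $ 2, f1 (p $ 1) + g (p $ 2), f2 (p $ 1) + h (p $ 2)]"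
  by (simp add: translation_surface_def graph_curve_def vec_eq_iff forall_3)

context
  fixes I J :: "real set" and f1 f2 g :: "real \<Rightarrow> real" and a :: real and r :: "real ^ 2 \<Rightarrow> real ^ 3"
  assumes I: "open I" and J: "open J"
    and smooth: "smooth_on I f1" "smooth_on I f2" "smooth_on J g"
  defines "r \<equiv> translation_surface (graph_curve f1 f2) (graph_curve g (\<lambda>v. a * v))"
begin

lemma pd_translation_surface:
  assumes "p \<in> rect I J"
  shows "pd 1 r p = vector [1, deriv f1 (p $ 1), deriv f2 (p $ 1)]"
    and "pd 2 r p = vector [1, deriv g (p $ 2), a]"
proof -
  have p: "p $ 1 \<in> I" "p $ 2 \<in> J" using assms by (auto simp: rect_def)
  \<comment> \<open>The factors 1 keep each summand in the form \<open>d * w $ i\<close> of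
    \<open>has_derivative_of_component\<close>.\<close>
  have "(r has_derivative (\<lambda>w. vector [1 * w $ 1 + 1 * w $ 2,
      deriv f1 (p $ 1) * w $ 1 + deriv g (p $ 2) * w $ 2, deriv f2 (p $ 1) * w $ 1 + a * w $ 2])) (at p)"
    unfolding r_def translation_surface_eq
    by (intro has_derivative_vector_3 has_derivative_add has_derivative_of_component
        smooth_on_deriv(1)[OF smooth(1) p(1)] smooth_on_deriv(1)[OF smooth(2) p(1)]
        smooth_on_deriv(1)[OF smooth(3) p(2)])
      (auto intro!: derivative_eq_intros)
  from pd_eq[OF open_rect[OF I J] assms refl this]
  show "pd 1 r p = vector [1, deriv f1 (p $ 1), deriv f2 (p $ 1)]"
    "pd 2 r p = vector [1, deriv g (p $ 2), a]"
    by (simp_all add: axis_def)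
qed

lemma pd_pd_translation_surface:
  assumes "p \<in> rect I J"
  shows "pd 1 (pd 1 r) p = vector [0, (deriv ^^ 2) f1 (p $ 1), (deriv ^^ 2) f2 (p $ 1)]"
    and "pd 1 (pd 2 r) p = 0"
    and "pd 2 (pd 2 r) p = vector [0, (deriv ^^ 2) g (p $ 2), 0]"
proof -
  have p: "p $ 1 \<in> I" "p $ 2 \<in> J" using assms by (auto simp: rect_def)
  have "((\<lambda>p. vector [1, deriv f1 (p $ 1), deriv f2 (p $ 1)] :: real ^ 3) has_derivative
      (\<lambda>w. vector [0, (deriv ^^ 2) f1 (p $ 1) * w $ 1, (deriv ^^ 2) f2 (p $ 1) * w $ 1])) (at p)"
    by (intro has_derivative_vector_3 has_derivative_const has_derivative_of_component
        smooth_on_deriv(2)[OF smooth(1) p(1)] smooth_on_deriv(2)[OF smooth(2) p(1)])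
  from pd_eq[OF open_rect[OF I J] assms pd_translation_surface(1) this]
  show "pd 1 (pd 1 r) p = vector [0, (deriv ^^ 2) f1 (p $ 1), (deriv ^^ 2) f2 (p $ 1)]"
    by (simp add: axis_def)
  have "((\<lambda>p. vector [1, deriv g (p $ 2), a] :: real ^ 3) has_derivative
      (\<lambda>w. vector [0, (deriv ^^ 2) g (p $ 2) * w $ 2, 0])) (at p)"
    by (intro has_derivative_vector_3 has_derivative_const has_derivative_of_component
        smooth_on_deriv(2)[OF smooth(3) p(2)])
  from pd_eq[OF open_rect[OF I J] assms pd_translation_surface(2) this]
  show "pd 2 (pd 2 r) p = vector [0, (deriv ^^ 2) g (p $ 2), 0]" "pd 1 (pd 2 r) p = 0"
    by (simp_all add: axis_def vec_eq_iff forall_3)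
qed

lemma surf_W_translation_surface:
  assumes "p \<in> rect I J"
  shows "(surf_W r p)\<^sup>2 = (deriv f2 (p $ 1) - a)\<^sup>2 + (deriv g (p $ 2) - deriv f1 (p $ 1))\<^sup>2"
  by (simp add: surf_W_def pd_translation_surface[OF assms] power2_commute)

text \<open>Both first partials have first component 1, so the choice of \<open>k\<close> is
  immaterial, and the correction term with \<open>x,ij\<close> vanishes by assumption.\<close>

lemma surf_L_translation_surface:
  assumes "p \<in> rect I J" and "pd i (pd j r) p $ 1 = 0"
  shows "surf_L r i j p = (pd i (pd j r) p $ 2 * (deriv f2 (p $ 1) - a)
    + pd i (pd j r) p $ 3 * (deriv g (p $ 2) - deriv f1 (p $ 1))) / surf_W r p"
proof -
  have pd1: "pd k r p $ 1 = 1" for k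
    using exhaust_2[of k] by (auto simp: pd_translation_surface[OF assms(1)])
  show ?thesis
    by (simp add: surf_L_def pd1 assms(2) surf_N_def inner_vec_def sum_3
        pd_translation_surface[OF assms(1)] algebra_simps add_divide_distrib diff_divide_distrib)
qed

text \<open>The mixed coefficient vanishes because the two parameters separate. The other two each
  carry a factor \<open>1 / surf_W r p\<close>, so clearing denominators leaves the fourth power of
  W, which is free of square roots.\<close>

lemma gauss_curvature_translation_surface:
  assumes "p \<in> rect I J" and "surf_W r p > 0"
  defines "A \<equiv> deriv f1 (p $ 1)" and "B \<equiv> deriv f2 (p $ 1) - a" and "G \<equiv> deriv g (p $ 2)"
  shows "gauss_curvature r p * (B\<^sup>2 + (G - A)\<^sup>2)\<^sup>2 =
    (deriv ^^ 2) g (p $ 2) * (B * ((deriv ^^ 2) f1 (p $ 1) * B + (deriv ^^ 2) f2 (p $ 1) * (G - A)))"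
proof -
  have "gauss_curvature r p * ((surf_W r p)\<^sup>2)\<^sup>2 =
    (deriv ^^ 2) g (p $ 2) * (B * ((deriv ^^ 2) f1 (p $ 1) * B + (deriv ^^ 2) f2 (p $ 1) * (G - A)))"
    using assms(2)
    by (simp add: gauss_curvature_def surf_L_translation_surface[OF assms(1)]
        pd_pd_translation_surface[OF assms(1)] A_def B_def G_def power2_eq_square)
  then show ?thesis
    by (simp only: surf_W_translation_surface[OF assms(1)] A_def B_def G_def)
qed

end

section \<open>The curvature equation\<close>

text \<open>A finite image of a connected ball is a single point, which would make \<open>h\<close>
  locally constant and its derivative zero.\<close>

lemma infinite_image_of_deriv_nonzero:
  fixes h :: "real \<Rightarrow> real"
  assumes "open S" "x \<in> S" "continuous_on S h" "(h has_real_derivative d) (at x)" "d \<noteq> 0"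
  shows "infinite (h ` S)"
proof
  assume fin: "finite (h ` S)"
  obtain e where e: "e > 0" "ball x e \<subseteq> S"
    using assms(1,2) openE by blast
  have "connected (h ` ball x e)"
    by (intro connected_continuous_image continuous_on_subset[OF assms(3) e(2)] connected_ball)
  moreover have "finite (h ` ball x e)"
    using fin e(2) by (meson finite_subset image_mono)
  ultimately obtain c where "h ` ball x e \<subseteq> {c}"
    by (metis connected_finite_iff_sing empty_subsetI order_refl)
  then have "h y = c" if "y \<in> ball x e" for y
    using that by blast
  then have "(h has_real_derivative 0) (at x)"
    using has_field_derivative_transform_within_open[of "\<lambda>x. c" 0 x "ball x e" h] e(1) by simp
  then show False
    using DERIV_unique assms(4,5) by blast
qed

text \<open>Infinitely many real \<open>t\<close> make this an identity of complex polynomials. At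
  the root \<open>A1 + i B1\<close> of the quartic on the right, the linear factor on the left is
  nonzero, so the other quartic vanishes there too.\<close>

lemma proportional_on_infinite_imp_center_eq:
  fixes A1 B1 p1 q1 A2 B2 p2 q2 :: real
  assumes "infinite T"
    and eq: "\<And>t. t \<in> T \<Longrightarrow> (p1 + q1 * (t - A1)) * (B2\<^sup>2 + (t - A2)\<^sup>2)\<^sup>2 =
      (p2 + q2 * (t - A2)) * (B1\<^sup>2 + (t - A1)\<^sup>2)\<^sup>2"
    and "p1 \<noteq> 0 \<or> q1 * B1 \<noteq> 0"
  shows "A1 = A2"
proof -
  define Q where "Q = (\<lambda>p q A :: real. [:complex_of_real p - of_real q * of_real A, of_real q:])"
  define R where "R = (\<lambda>A B :: real. [:complex_of_real B ^ 2 + of_real A ^ 2, - 2 * of_real A, 1:] ^ 2)"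
  have Q: "poly (Q p q A) z = of_real p + of_real q * (z - of_real A)" for p q A z
    by (simp add: Q_def algebra_simps)
  have R: "poly (R A B) z = (of_real B ^ 2 + (z - of_real A)\<^sup>2)\<^sup>2" for A B z
    by (simp add: R_def algebra_simps power2_eq_square)
  define P where "P = Q p1 q1 A1 * R A2 B2 - Q p2 q2 A2 * R A1 B1"
  have "poly P (of_real t) = 0" if "t \<in> T" for t
  proof -
    have "poly P (of_real t) = of_real ((p1 + q1 * (t - A1)) * (B2\<^sup>2 + (t - A2)\<^sup>2)\<^sup>2 -
      (p2 + q2 * (t - A2)) * (B1\<^sup>2 + (t - A1)\<^sup>2)\<^sup>2)"
      by (simp add: P_def Q R)
    then show ?thesis using eq[OF that] by simp
  qed
  then have "complex_of_real ` T \<subseteq> {z. poly P z = 0}" by auto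
  moreover have "infinite (complex_of_real ` T)"
    using assms(1) by (simp add: finite_image_iff inj_on_def)
  ultimately have "P = 0"
    using poly_roots_finite finite_subset by blast
  define z where "z = Complex A1 B1"
  have z: "z - of_real A1 = \<i> * of_real B1"
    by (simp add: z_def complex_eq_iff)
  have "poly (R A1 B1) z = 0"
    by (simp add: R z power_mult_distrib)
  \<comment> \<open>The real and imaginary parts are exactly the two quantities in the third
    assumption.\<close>
  moreover have "poly (Q p1 q1 A1) z = Complex p1 (q1 * B1)"
    by (simp add: Q z complex_eq_iff)
  then have "poly (Q p1 q1 A1) z \<noteq> 0"
    using assms(3) by (auto simp: complex_eq_iff)
  moreover have "poly P z = 0" using \<open>P = 0\<close> by simp
  ultimately have "poly (R A2 B2) z = 0" by (simp add: P_def)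
  then have *: "of_real B2 ^ 2 + (z - of_real A2)\<^sup>2 = 0" by (simp add: R)
  have "(A1 - A2)\<^sup>2 + B2\<^sup>2 = B1\<^sup>2" "(A1 - A2) * B1 = 0"
    using arg_cong[OF *, of Re] arg_cong[OF *, of Im]
    by (simp_all add: z_def power2_eq_square algebra_simps)
  \<comment> \<open>If \<open>B1 = 0\<close>, the real part is a vanishing sum of squares; otherwise
    the imaginary part gives the claim.\<close>
  then show "A1 = A2"
    by (cases "B1 = 0") auto
qed

text \<open>The assumptions \<open>deriv\<close>, \<open>A\<close> and \<open>B\<close> are all that is needed of the torsion condition.\<close>

lemma curvature_equation_inconsistent:
  fixes A B A' B' :: "'a \<Rightarrow> real" and G G' :: "'b \<Rightarrow> real"
  assumes eq: "\<And>u v. u \<in> I \<Longrightarrow> v \<in> J \<Longrightarrow>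
      K * ((B u)\<^sup>2 + (G v - A u)\<^sup>2)\<^sup>2 = G' v * (B u * (A' u * B u + B' u * (G v - A u)))"
    and pos: "\<And>u v. u \<in> I \<Longrightarrow> v \<in> J \<Longrightarrow> (B u)\<^sup>2 + (G v - A u)\<^sup>2 > 0"
    and deriv: "\<And>u. u \<in> I \<Longrightarrow> A' u \<noteq> 0 \<or> B' u \<noteq> 0"
    and A: "\<not> A constant_on I" and B: "\<exists>u\<in>I. B u \<noteq> 0"
    and inf: "infinite (G ` {v\<in>J. G' v \<noteq> 0})"
  shows False
proof (cases "K = 0")
  case True
  obtain u where u: "u \<in> I" "B u \<noteq> 0" using B by blast
  have zero: "A' u * B u + B' u * (t - A u) = 0" if "t \<in> G ` {v\<in>J. G' v \<noteq> 0}" for t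
    using that eq[OF u(1)] True u(2) by auto
  \<comment> \<open>Otherwise the linear equation \<open>zero\<close> would allow only one value of
    \<open>t\<close>.\<close>
  have "B' u = 0"
  proof (rule ccontr)
    assume "B' u \<noteq> 0"
    then have "t = A u - A' u * B u / B' u" if "t \<in> G ` {v\<in>J. G' v \<noteq> 0}" for t
      using zero[OF that] by (simp add: field_simps)
    then have "G ` {v\<in>J. G' v \<noteq> 0} \<subseteq> {A u - A' u * B u / B' u}" by blast
    then show False using inf finite_subset by blast
  qed
  moreover from inf obtain t where "t \<in> G ` {v\<in>J. G' v \<noteq> 0}"
    by (metis ex_in_conv finite.emptyI)
  ultimately show False using zero[of t] u deriv[of u] by auto
next
  case False
  obtain v where v: "v \<in> J"
    using inf by (metis (no_types, lifting) empty_Collect_eq finite.emptyI image_empty)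
  \<comment> \<open>Where \<open>B u = 0\<close>, the right side of \<open>eq\<close> vanishes but
    the left side does not.\<close>
  have "B u \<noteq> 0" if "u \<in> I" for u
    using eq[OF that v] pos[OF that v] False by auto
  moreover have "A u = A w" if uw: "u \<in> I" "w \<in> I" and "B u \<noteq> 0" for u w
  proof (rule proportional_on_infinite_imp_center_eq[OF inf])
    fix t assume "t \<in> G ` {v\<in>J. G' v \<noteq> 0}"
    then obtain v where v: "v \<in> J" "G' v \<noteq> 0" "t = G v" by blast
    \<comment> \<open>To eliminate \<open>G' v\<close>, the right side of \<open>eq\<close> at
      \<open>u\<close> is multiplied by the left side at \<open>w\<close>; \<open>eq\<close>
      exchanges both factors, and the nonzero \<open>K * G' v\<close> cancels.\<close>
    have "K * G' v * ((B u * A' u * B u + B u * B' u * (t - A u)) * ((B w)\<^sup>2 + (t - A w)\<^sup>2)\<^sup>2)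
      = (G' v * (B u * (A' u * B u + B' u * (G v - A u)))) * (K * ((B w)\<^sup>2 + (G v - A w)\<^sup>2)\<^sup>2)"
      by (simp add: v(3) algebra_simps)
    also have "\<dots> = (K * ((B u)\<^sup>2 + (G v - A u)\<^sup>2)\<^sup>2) *
        (G' v * (B w * (A' w * B w + B' w * (G v - A w))))"
      using eq[OF uw(1) v(1)] eq[OF uw(2) v(1)] by (simp only:)
    also have "\<dots> = K * G' v *
        ((B w * A' w * B w + B w * B' w * (t - A w)) * ((B u)\<^sup>2 + (t - A u)\<^sup>2)\<^sup>2)"
      by (simp add: v(3) algebra_simps)
    finally show "(B u * A' u * B u + B u * B' u * (t - A u)) * ((B w)\<^sup>2 + (t - A w)\<^sup>2)\<^sup>2 =
        (B w * A' w * B w + B w * B' w * (t - A w)) * ((B u)\<^sup>2 + (t - A u)\<^sup>2)\<^sup>2"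
      using False v(2) by simp
  next
    show "B u * A' u * B u \<noteq> 0 \<or> B u * B' u * B u \<noteq> 0"
      using deriv[OF uw(1)] that(3) by simp
  qed
  ultimately show False
    using A unfolding constant_on_def by metis
qed

lemma deriv_locally_constant:
  fixes f :: "real \<Rightarrow> real"
  assumes "open S" "x \<in> S" "\<And>y. y \<in> S \<Longrightarrow> f y = c"
  shows "deriv f x = 0"
  by (rule DERIV_imp_deriv, rule has_field_derivative_transform_within_open[OF DERIV_const assms(1,2)])
    (simp add: assms(3))

section \<open>Rulings along an affine graph\<close>

text \<open>The given parameters already work: \<open>v\<close> enters only through \<open>v\<close>
  times the vector (1, c, a), and the constant \<open>d\<close> is absorbed into the base
  curve.\<close>

lemma generalized_cylinder_of_affine:
  fixes r :: "real ^ 2 \<Rightarrow> real ^ 3"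
  assumes I: "open_interval I" and J: "open_interval J"
    and smooth: "smooth_on I f1" "smooth_on I f2"
    and g: "\<And>v. v \<in> J \<Longrightarrow> g v = c * v + d"
  shows "generalized_cylinder_along (rect I J)
    (translation_surface (graph_curve f1 f2) (graph_curve g (\<lambda>v. a * v))) (vector [1, c, a])"
proof -
  have "open I" "open J" using I J by (auto simp: open_interval_def)
  have "smooth_on I (\<lambda>u. u *\<^sub>R axis 1 1 + f1 u *\<^sub>R axis 2 1 + f2 u *\<^sub>R axis 3 1 + d *\<^sub>R axis 2 1 :: real ^ 3)"
    by (intro smooth_on_add smooth_on_bounded_linear_compose[OF bounded_linear_scaleR_left]
        smooth_on_const smooth_on_ident smooth \<open>open I\<close>)
  also have "(\<lambda>u. u *\<^sub>R axis 1 1 + f1 u *\<^sub>R axis 2 1 + f2 u *\<^sub>R axis 3 1 + d *\<^sub>R axis 2 1 :: real ^ 3)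
      = (\<lambda>u. vector [u, f1 u + d, f2 u])"
    by (simp add: vector_3_eq_axis_sum algebra_simps)
  finally have \<gamma>: "smooth_on I (\<lambda>u. vector [u, f1 u + d, f2 u] :: real ^ 3)" .
  have "smooth_on (rect I J) (\<lambda>p. p)"
    by (intro smooth_on_ident open_rect \<open>open I\<close> \<open>open J\<close>)
  then have \<phi>: "diffeomorphism (rect I J) (rect I J) (\<lambda>p. p)"
    unfolding diffeomorphism_def by auto
  have e: "(vector [1, c, a] :: real ^ 3) \<noteq> 0"
    by (simp add: vec_eq_iff forall_3)
  have "translation_surface (graph_curve f1 f2) (graph_curve g (\<lambda>v. a * v)) p =
      vector [p $ 1, f1 (p $ 1) + d, f2 (p $ 1)] + (p $ 2) *\<^sub>R vector [1, c, a]"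
    if "p \<in> rect I J" for p
    using that g[of "p $ 2"]
    by (simp add: translation_surface_eq rect_def vec_eq_iff forall_3 algebra_simps)
  then show ?thesis
    unfolding generalized_cylinder_along_def using I J \<gamma> \<phi> e by blast
qed

section \<open>From constant curvature to an affine \<open>g\<close>\<close>

theorem theorem5p1:
  fixes I J :: "real set" and f1 f2 g :: "real \<Rightarrow> real" and a K0 :: real
    and r :: "real ^ 2 \<Rightarrow> real ^ 3"
  defines "r \<equiv> translation_surface (graph_curve f1 f2) (graph_curve g (\<lambda>v. a * v))"
  assumes "open_interval I" and "open_interval J"
    and "smooth_on I f1" and "smooth_on I f2" and "smooth_on J g"
    and "space_curve_on I f1 f2"
    and "regular_on (rect I J) r"
    and "\<forall>p\<in>rect I J. gauss_curvature r p = K0"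
  shows "(\<exists>e. generalized_cylinder_along (rect I J) r e \<and> \<not> isotropic e) \<and> K0 = 0"
proof -
  have I: "open I" "I \<noteq> {}" and J: "open J" "convex J" "J \<noteq> {}"
    using assms(2,3) by (auto simp: open_interval_def is_interval_convex)
  define A where "A = deriv f1"
  define B where "B = (\<lambda>u. deriv f2 u - a)"
  have torsion: "(deriv ^^ 2) f1 u * (deriv ^^ 3) f2 u - (deriv ^^ 3) f1 u * (deriv ^^ 2) f2 u \<noteq> 0"
    if "u \<in> I" for u
    using assms(7) that by (simp add: space_curve_on_def)
  have eq: "K0 * ((B u)\<^sup>2 + (deriv g v - A u)\<^sup>2)\<^sup>2 =
      (deriv ^^ 2) g v * (B u * ((deriv ^^ 2) f1 u * B u + (deriv ^^ 2) f2 u * (deriv g v - A u)))"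
    and pos: "(B u)\<^sup>2 + (deriv g v - A u)\<^sup>2 > 0" if "u \<in> I" "v \<in> J" for u v
  proof -
    define p :: "real ^ 2" where "p = vector [u, v]"
    have p: "p \<in> rect I J" "p $ 1 = u" "p $ 2 = v" using that by (simp_all add: p_def rect_def)
    have W: "surf_W r p > 0" using assms(8) p(1) by (simp add: regular_on_def)
    show "K0 * ((B u)\<^sup>2 + (deriv g v - A u)\<^sup>2)\<^sup>2 =
      (deriv ^^ 2) g v * (B u * ((deriv ^^ 2) f1 u * B u + (deriv ^^ 2) f2 u * (deriv g v - A u)))"
      using gauss_curvature_translation_surface[OF I(1) J(1) assms(4-6) p(1) W[unfolded r_def]]
        assms(9) p by (simp add: A_def B_def r_def)
    show "(B u)\<^sup>2 + (deriv g v - A u)\<^sup>2 > 0"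
      using surf_W_translation_surface[OF I(1) J(1) assms(4-6) p(1), of a] W p
      by (metis A_def B_def r_def zero_less_power)
  qed
  have deriv2: "(deriv ^^ 2) f = (\<lambda>u. deriv (deriv f) u)" "(deriv ^^ 3) f = (\<lambda>u. deriv ((deriv ^^ 2) f) u)"
    for f :: "real \<Rightarrow> real"
    by (simp_all add: numeral_2_eq_2 numeral_3_eq_3)
  \<comment> \<open>If the second derivative vanished on all of \<open>I\<close>, so would the
    third, and with them the torsion determinant.\<close>
  have nonconst: "\<not> (\<forall>u\<in>I. (deriv ^^ 2) f u = 0)" if "f = f1 \<or> f = f2" for f
  proof
    assume *: "\<forall>u\<in>I. (deriv ^^ 2) f u = 0"
    obtain u where u: "u \<in> I" using I by blast
    have "(deriv ^^ 3) f u = 0"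
      using deriv_locally_constant[OF I(1) u, of "(deriv ^^ 2) f" 0] * by (simp add: deriv2(2))
    with * u torsion[OF u] that show False by auto
  qed
  have zero: "(deriv ^^ 2) g v = 0" if v: "v \<in> J" for v
  proof (rule ccontr)
    assume v0: "(deriv ^^ 2) g v \<noteq> 0"
    have "continuous_on J ((deriv ^^ 2) g)" "continuous_on J (deriv g)"
      using smooth_on_higher_deriv[OF assms(6), where n = 2] smooth_on_deriv(2)[OF assms(6)]
      by (meson DERIV_isCont continuous_at_imp_continuous_on)+
    \<comment> \<open>The values of \<open>deriv g\<close> are counted only where its derivative is
      nonzero, since only there can \<open>G' v\<close> be cancelled; this set is open and contains
      \<open>v\<close>.\<close>
    then have "open (J \<inter> (deriv ^^ 2) g -` (- {0}))"
      by (intro continuous_open_preimage J(1)) auto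
    moreover have "J \<inter> (deriv ^^ 2) g -` (- {0}) = {v\<in>J. (deriv ^^ 2) g v \<noteq> 0}" by auto
    ultimately have "infinite (deriv g ` {v\<in>J. (deriv ^^ 2) g v \<noteq> 0})"
      using v v0 smooth_on_deriv(2)[OF assms(6) v] \<open>continuous_on J (deriv g)\<close>
      by (intro infinite_image_of_deriv_nonzero[of _ v]) (auto elim: continuous_on_subset)
    moreover have "\<not> A constant_on I"
      using deriv_locally_constant[OF I(1), of _ "deriv f1"] nonconst[of f1]
      unfolding constant_on_def A_def deriv2(1) by metis
    \<comment> \<open>Otherwise \<open>deriv f2\<close> would be constantly \<open>a\<close>,
      against \<open>nonconst\<close>.\<close>
    moreover have "\<exists>u\<in>I. B u \<noteq> 0"
      using deriv_locally_constant[OF I(1), of _ "deriv f2" a] nonconst[of f2]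
      unfolding B_def deriv2(1) by force
    moreover have "(deriv ^^ 2) f1 u \<noteq> 0 \<or> (deriv ^^ 2) f2 u \<noteq> 0" if "u \<in> I" for u
      using torsion[OF that] by auto
    ultimately show False
      using curvature_equation_inconsistent[of I J K0 B "deriv g" A "(deriv ^^ 2) g"
          "(deriv ^^ 2) f1" "(deriv ^^ 2) f2"] eq pos by blast
  qed
  obtain c where c: "\<And>v. v \<in> J \<Longrightarrow> deriv g v = c"
    using has_field_derivative_zero_constant[OF J(2), of "deriv g"] smooth_on_deriv(2)[OF assms(6)] zero
    by (metis has_field_derivative_at_within)
  have "((\<lambda>v. g v - c * v) has_real_derivative 0) (at v within J)" if "v \<in> J" for v
    using smooth_on_deriv(1)[OF assms(6) that] c[OF that]
    by (auto intro!: derivative_eq_intros intro: has_field_derivative_at_within)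
  then obtain d where "\<And>v. v \<in> J \<Longrightarrow> g v - c * v = d"
    using has_field_derivative_zero_constant[OF J(2), of "\<lambda>v. g v - c * v"] by blast
  then have "\<And>v. v \<in> J \<Longrightarrow> g v = c * v + d" by (simp add: algebra_simps)
  then have "generalized_cylinder_along (rect I J) r (vector [1, c, a])"
    unfolding r_def by (rule generalized_cylinder_of_affine[OF assms(2-5)])
  moreover have "\<not> isotropic (vector [1, c, a])" by (simp add: isotropic_def)
  \<comment> \<open>Now the right side of \<open>eq\<close> is zero, while \<open>K0\<close> is
    multiplied by a positive number.\<close>
  moreover have "K0 = 0"
  proof -
    obtain u v where "u \<in> I" "v \<in> J" using I J by blast
    then show ?thesis using eq[of u v] pos[of u v] zero[of v] by auto
  qed
  ultimately show ?thesis by blast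
qed

end
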